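(* Let $X$ be a nonempty set, let $L$ be a truncated vector sublattice of $\mathbb{R}^{X}$, and let $\psi$ be a nonzero linear functional on $L$. Then the following are equivalent. (i) $\psi$ is a truncation homomorphism on $L$. (ii) $\psi$ is an $\overline{n}$-evaluation on $L$ for all $n\in\{1,2,\dots\}$. (iii) $\psi$ is a $\overline{2}$-evaluation on $L$. (iv) There exists a net $(x_{\sigma})$ of elements of $X$ such that $\psi(f)=\lim f(x_{\sigma})$ in $\mathbb{R}$ for all $f\in L$.
   Context: $\mathbb{R}^{X}$ is the set of all real-valued functions on the nonempty set $X$, with pointwise vector space operations and pointwise order, so $(f\wedge g)(x)=\min\{f(x),g(x)\}$. $\mathbf{1}_{X}$ is the constant function $1$ on $X$. A vector sublattice of $\mathbb{R}^{X}$ is a linear subspace closed under pointwise minimum and maximum. A truncated vector sublattice of $\mathbb{R}^{X}$ is a vector sublattice $L$ of $\mathbb{R}^{X}$ such that $f\wedge\mathbf{1}_{X}\in L$ for all $f\in L$ (it is not assumed that $\mathbf{1}_{X}\in L$). A truncation homomorphism on $L$ is a nonzero linear functional $\psi:L\to\mathbb{R}$ such that $\psi(f\wedge\mathbf{1}_{X})=\min\{\psi(f),1\}$ for all $f\in L$. For $n\in\{1,2,\dots\}$, a linear functional $\psi$ on $L$ is an $\overline{n}$-evaluation if for all $f_{1},\dots,f_{n}\in L$ and every $\varepsilon\in(0,\infty)$ there exists $x\in X$ such that $|\psi(f_{k})-f_{k}(x)|\leq\varepsilon$ for all $k\in\{1,\dots,n\}$. *)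

theory Defs
  imports Complex_Main "HOL-Library.Function_Algebras"
begin

text \<open>
  The set \<open>X\<close> is the universe of a type \<open>'x\<close>, so that \<open>\<real>\<^sup>X\<close> is the type \<open>'x \<Rightarrow> real\<close>.  Addition, \<open>0\<close>
  and \<open>1\<close> (the constant function) come from \<^theory>\<open>HOL-Library.Function_Algebras\<close>, and \<open>inf\<close>,
  \<open>sup\<close> on functions are pointwise in \<^theory>\<open>Main\<close>; only scalar multiplication is missing.
\<close>

instantiation "fun" :: (type, real_vector) real_vector
begin

definition scaleR_fun :: "real \<Rightarrow> ('a \<Rightarrow> 'b) \<Rightarrow> 'a \<Rightarrow> 'b" where
  "scaleR_fun c f = (\<lambda>x. c *\<^sub>R f x)"

instance
  by standard (simp_all add: scaleR_fun_def fun_eq_iff scaleR_add_left scaleR_add_right)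

end

lemma scaleR_fun_apply [simp]: "(c *\<^sub>R f) x = c *\<^sub>R f x"
  by (simp add: scaleR_fun_def)

definition vector_sublattice :: "('x \<Rightarrow> real) set \<Rightarrow> bool" where
  "vector_sublattice L \<longleftrightarrow> subspace L \<and> (\<forall>f\<in>L. \<forall>g\<in>L. inf f g \<in> L \<and> sup f g \<in> L)"

definition truncated_vector_sublattice :: "('x \<Rightarrow> real) set \<Rightarrow> bool" where
  "truncated_vector_sublattice L \<longleftrightarrow> vector_sublattice L \<and> (\<forall>f\<in>L. inf f 1 \<in> L)"

text \<open>
  A functional on \<open>L\<close> is represented by a function on all of \<open>'x \<Rightarrow> real\<close>; its values outside \<open>L\<close>
  are irrelevant.
\<close>

definition linear_functional_on :: "('x \<Rightarrow> real) set \<Rightarrow> (('x \<Rightarrow> real) \<Rightarrow> real) \<Rightarrow> bool" where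
  "linear_functional_on L \<psi> \<longleftrightarrow>
     (\<forall>f\<in>L. \<forall>g\<in>L. \<psi> (f + g) = \<psi> f + \<psi> g) \<and> (\<forall>c. \<forall>f\<in>L. \<psi> (c *\<^sub>R f) = c * \<psi> f)"

definition nonzero_on :: "('x \<Rightarrow> real) set \<Rightarrow> (('x \<Rightarrow> real) \<Rightarrow> real) \<Rightarrow> bool" where
  "nonzero_on L \<psi> \<longleftrightarrow> (\<exists>f\<in>L. \<psi> f \<noteq> 0)"

definition truncation_homomorphism :: "('x \<Rightarrow> real) set \<Rightarrow> (('x \<Rightarrow> real) \<Rightarrow> real) \<Rightarrow> bool" where
  "truncation_homomorphism L \<psi> \<longleftrightarrow>
     linear_functional_on L \<psi> \<and> nonzero_on L \<psi> \<and> (\<forall>f\<in>L. \<psi> (inf f 1) = min (\<psi> f) 1)"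

text \<open>The \<open>n\<close>-evaluations with overlined \<open>n\<close>.\<close>

definition approx_evaluation ::
    "nat \<Rightarrow> ('x \<Rightarrow> real) set \<Rightarrow> (('x \<Rightarrow> real) \<Rightarrow> real) \<Rightarrow> bool" where
  "approx_evaluation n L \<psi> \<longleftrightarrow>
     linear_functional_on L \<psi> \<and>
     (\<forall>f :: nat \<Rightarrow> 'x \<Rightarrow> real. (\<forall>k\<in>{1..n}. f k \<in> L) \<longrightarrow>
        (\<forall>\<epsilon>>0. \<exists>x. \<forall>k\<in>{1..n}. \<bar>\<psi> (f k) - f k x\<bar> \<le> \<epsilon>))"

definition directed_set :: "'i set \<Rightarrow> ('i \<Rightarrow> 'i \<Rightarrow> bool) \<Rightarrow> bool" where
  "directed_set D le \<longleftrightarrow>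
     D \<noteq> {} \<and> reflp_on D le \<and> transp_on D le \<and> (\<forall>i\<in>D. \<forall>j\<in>D. \<exists>k\<in>D. le i k \<and> le j k)"

text \<open>
  Convergence of a net indexed by \<open>(D, le)\<close> is convergence along the filter generated by the tails
  of \<open>D\<close>.
\<close>

definition tail_filter :: "'i set \<Rightarrow> ('i \<Rightarrow> 'i \<Rightarrow> bool) \<Rightarrow> 'i filter" where
  "tail_filter D le = (INF i\<in>D. principal {j\<in>D. le i j})"

lemma eventually_tail_filter:
  assumes "directed_set D le"
  shows "eventually P (tail_filter D le) \<longleftrightarrow> (\<exists>i\<in>D. \<forall>j\<in>D. le i j \<longrightarrow> P j)"
proof -
  have "\<exists>k\<in>D. principal {l\<in>D. le k l} \<le> inf (principal {l\<in>D. le i l}) (principal {l\<in>D. le j l})"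
    if "i \<in> D" "j \<in> D" for i j
  proof -
    obtain k where k: "k \<in> D" "le i k" "le j k"
      using assms \<open>i \<in> D\<close> \<open>j \<in> D\<close> unfolding directed_set_def by blast
    have "le i l \<and> le j l" if "l \<in> D" "le k l" for l
      using assms k \<open>i \<in> D\<close> \<open>j \<in> D\<close> that unfolding directed_set_def transp_on_def by blast
    with \<open>k \<in> D\<close> show ?thesis by (auto intro!: bexI[of _ k])
  qed
  moreover have "D \<noteq> {}" using assms by (simp add: directed_set_def)
  ultimately show ?thesis
    unfolding tail_filter_def
    by (subst eventually_INF_base) (auto simp: eventually_principal)
qed

definition net_limit_on ::
    "'i set \<Rightarrow> ('i \<Rightarrow> 'i \<Rightarrow> bool) \<Rightarrow> ('i \<Rightarrow> 'x) \<Rightarrow> ('x \<Rightarrow> real) set \<Rightarrow> (('x \<Rightarrow> real) \<Rightarrow> real) \<Rightarrow> bool" where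
  "net_limit_on D le x L \<psi> \<longleftrightarrow>
     directed_set D le \<and> (\<forall>f\<in>L. ((\<lambda>\<sigma>. f (x \<sigma>)) \<longlongrightarrow> \<psi> f) (tail_filter D le))"

text \<open>
  HOL cannot quantify existentially over the type of the index set.  The index type
  \<open>'x set \<times> 'x\<close> is large enough: every net of elements of \<open>'x\<close>, whatever its index type, can be
  replaced by one indexed by the pairs \<open>(A, a)\<close> where \<open>a \<in> A\<close> and the net is eventually in \<open>A\<close>,
  ordered by reverse inclusion of the first components.
\<close>

lemma net_limit_on_index_type:
  fixes D :: "'i set" and x :: "'i \<Rightarrow> 'x"
  assumes "net_limit_on D le x L \<psi>"
  shows "\<exists>(D' :: ('x set \<times> 'x) set) le' x'. net_limit_on D' le' x' L \<psi>"
proof -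
  define D' where "D' = {(A, a). a \<in> A \<and> eventually (\<lambda>\<sigma>. x \<sigma> \<in> A) (tail_filter D le)}"
  define le' where "le' = (\<lambda>(p :: 'x set \<times> 'x) (q :: 'x set \<times> 'x). fst q \<subseteq> fst p)"
  have dir: "directed_set D le" using assms by (simp add: net_limit_on_def)
  have nb: "\<exists>a. a \<in> A" if "eventually (\<lambda>\<sigma>. x \<sigma> \<in> A) (tail_filter D le)" for A
    using that dir unfolding eventually_tail_filter[OF dir] directed_set_def reflp_on_def by blast
  have dir': "directed_set D' le'"
    unfolding directed_set_def
  proof (intro conjI ballI)
    show "D' \<noteq> {}"
      using nb[of UNIV] by (auto simp: D'_def intro!: exI[of _ UNIV])
    show "reflp_on D' le'" "transp_on D' le'"
      by (auto simp: reflp_on_def transp_on_def le'_def)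
    fix p q assume "p \<in> D'" "q \<in> D'"
    then have "eventually (\<lambda>\<sigma>. x \<sigma> \<in> fst p \<inter> fst q) (tail_filter D le)"
      by (auto simp: D'_def eventually_conj_iff)
    moreover from nb[OF this] obtain a where "a \<in> fst p \<inter> fst q" by blast
    ultimately have "(fst p \<inter> fst q, a) \<in> D'" by (simp add: D'_def)
    then show "\<exists>r\<in>D'. le' p r \<and> le' q r" by (rule rev_bexI) (simp add: le'_def)
  qed
  have "((\<lambda>p. f (snd p)) \<longlongrightarrow> \<psi> f) (tail_filter D' le')" if "f \<in> L" for f
  proof (rule topological_tendstoI)
    fix S :: "real set" assume "open S" "\<psi> f \<in> S"
    then have ev: "eventually (\<lambda>\<sigma>. x \<sigma> \<in> {y. f y \<in> S}) (tail_filter D le)"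
      using assms that by (auto simp: net_limit_on_def tendsto_def)
    from nb[OF this] obtain a where "f a \<in> S" by blast
    with ev have "({y. f y \<in> S}, a) \<in> D'" by (simp add: D'_def)
    then show "eventually (\<lambda>p. f (snd p) \<in> S) (tail_filter D' le')"
      unfolding eventually_tail_filter[OF dir']
      by (rule rev_bexI) (auto simp: le'_def D'_def)
  qed
  with dir' show ?thesis unfolding net_limit_on_def by blast
qed

end

(*
  A truncation homomorphism is positive and commutes with finite lattice operations: min(f, 0) is
  squeezed using min(f, c) - min(f, 0) = min(max(f, 0), c) as c tends to 0.  To approximate psi on a
  finite set F by a point, choose v in L with psi v = 2 and put u = min(v, 1), w = v - u.  Then
  psi u = psi w = 1, and u = 1 wherever w > 0.  The sum G of all |f - psi(f) u| with f in F satisfies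
  psi G = 0, so it cannot dominate min(w, e), on which psi is positive; at a point where G < min(w, e)
  every f in F is within e of psi f.  The point sets obtained in this way form a filter base, whose
  associated net converges to psi.
*)
theory Submission
  imports Defs
begin

lemma linear_functional_on_add:
  "linear_functional_on L \<psi> \<Longrightarrow> f \<in> L \<Longrightarrow> g \<in> L \<Longrightarrow> \<psi> (f + g) = \<psi> f + \<psi> g"
  by (simp add: linear_functional_on_def)

lemma linear_functional_on_scaleR:
  "linear_functional_on L \<psi> \<Longrightarrow> f \<in> L \<Longrightarrow> \<psi> (c *\<^sub>R f) = c * \<psi> f"
  by (simp add: linear_functional_on_def)

lemma linear_functional_on_diff:
  assumes "linear_functional_on L \<psi>" "subspace L" "f \<in> L" "g \<in> L"
  shows "\<psi> (f - g) = \<psi> f - \<psi> g"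
proof -
  have "f - g \<in> L" using assms by (simp add: subspace_diff)
  from linear_functional_on_add[OF assms(1) this assms(4)] show ?thesis by simp
qed

section \<open>Positivity and lattice operations under a truncation homomorphism\<close>

locale truncation_homomorphism_on =
  fixes L :: "('x \<Rightarrow> real) set" and \<psi> :: "('x \<Rightarrow> real) \<Rightarrow> real"
  assumes lattice: "truncated_vector_sublattice L"
    and hom: "truncation_homomorphism L \<psi>"
begin

lemma subspace: "subspace L"
  and inf_in: "f \<in> L \<Longrightarrow> g \<in> L \<Longrightarrow> inf f g \<in> L"
  and inf_one_in: "f \<in> L \<Longrightarrow> inf f 1 \<in> L"
  using lattice by (simp_all add: truncated_vector_sublattice_def vector_sublattice_def)

lemmas closed = subspace_0[OF subspace] subspace_add[OF subspace] subspace_diff[OF subspace]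
  subspace_scale[OF subspace] inf_in inf_one_in

lemma linear: "linear_functional_on L \<psi>"
  and inf_one: "f \<in> L \<Longrightarrow> \<psi> (inf f 1) = min (\<psi> f) 1"
  using hom by (simp_all add: truncation_homomorphism_def)

lemmas add = linear_functional_on_add[OF linear]
lemmas diff = linear_functional_on_diff[OF linear subspace]
lemmas scaleR = linear_functional_on_scaleR[OF linear]

lemma zero: "\<psi> 0 = 0"
  using scaleR[of 0 0] by (simp add: closed)

text \<open>A negative value would allow rescaling by a negative \<open>c\<close> to the value 2.
  But \<open>c *\<^sub>R f\<close> is then at most 0 and so is fixed by truncation, which would
  force its value to be at most 1.\<close>

lemma nonneg:
  assumes "f \<in> L" "0 \<le> f"
  shows "0 \<le> \<psi> f"
proof (rule ccontr)
  assume "\<not> 0 \<le> \<psi> f"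
  then have neg: "\<psi> f < 0" by simp
  define c where "c = 2 / \<psi> f"
  have c: "c < 0" "c * \<psi> f = 2" using neg by (simp_all add: c_def field_simps)
  have "inf (c *\<^sub>R f) 1 = c *\<^sub>R f"
  proof
    fix x
    have "c * f x \<le> 0" using c assms(2) by (simp add: le_fun_def mult_nonpos_nonneg)
    then show "inf (c *\<^sub>R f) 1 x = (c *\<^sub>R f) x" by (simp add: inf_min)
  qed
  then have "c * \<psi> f = min (c * \<psi> f) 1"
    using inf_one[of "c *\<^sub>R f"] assms by (simp add: closed scaleR)
  with c show False by simp
qed

lemma mono:
  assumes "f \<in> L" "g \<in> L" "f \<le> g"
  shows "\<psi> f \<le> \<psi> g"
proof -
  have "0 \<le> \<psi> (g - f)"
    using assms by (intro nonneg) (simp_all add: closed le_fun_def)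
  then show ?thesis using assms by (simp add: diff)
qed

text \<open>Rescaling by \<open>c\<close> turns truncation at 1 into truncation at any positive
  level.\<close>

lemma inf_const:
  assumes "f \<in> L" "c > 0"
  shows "inf f (\<lambda>_. c) \<in> L" and "\<psi> (inf f (\<lambda>_. c)) = min (\<psi> f) c"
proof -
  have eq: "inf f (\<lambda>_. c) = c *\<^sub>R inf ((1 / c) *\<^sub>R f) 1"
    using assms by (auto simp: fun_eq_iff inf_min min_def field_simps)
  show "inf f (\<lambda>_. c) \<in> L" using assms by (simp add: eq closed)
  have "\<psi> (inf f (\<lambda>_. c)) = c * min (\<psi> f / c) 1"
    using assms by (simp add: eq closed scaleR inf_one)
  also have "\<dots> = min (\<psi> f) c" using assms by (auto simp: min_def field_simps)
  finally show "\<psi> (inf f (\<lambda>_. c)) = min (\<psi> f) c" .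
qed

lemma inf_zero:
  assumes f: "f \<in> L"
  shows "\<psi> (inf f 0) = min (\<psi> f) 0"
proof (rule antisym)
  have le: "inf f 0 \<in> L" using f by (simp add: closed)
  have "\<psi> (inf f 0) \<le> \<psi> f" "\<psi> (inf f 0) \<le> \<psi> 0"
    using f by (auto intro!: mono simp: closed)
  then show "\<psi> (inf f 0) \<le> min (\<psi> f) 0" by (simp add: zero)
  show "min (\<psi> f) 0 \<le> \<psi> (inf f 0)"
  proof (rule field_le_epsilon)
    fix c :: real assume c: "c > 0"
    \<comment> \<open>The function \<open>f - inf f 0\<close> is the positive part of
      \<open>f\<close>; by \<open>inf_const\<close> its truncation at \<open>c\<close> has value at
      most \<open>c\<close>.\<close>
    have "inf f (\<lambda>_. c) - inf f 0 = inf (f - inf f 0) (\<lambda>_. c)"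
      using c by (auto simp: fun_eq_iff inf_min min_def)
    then have "\<psi> (inf f (\<lambda>_. c)) - \<psi> (inf f 0) \<le> c"
      using inf_const[OF _ c, of "f - inf f 0"] inf_const(1)[OF f c] f le diff
      by (metis min.cobounded2 closed(3))
    then show "min (\<psi> f) 0 \<le> \<psi> (inf f 0) + c"
      using c by (simp add: inf_const[OF f c])
  qed
qed

lemma abs:
  assumes f: "f \<in> L"
  shows "(\<lambda>x. \<bar>f x\<bar>) \<in> L" and "\<psi> (\<lambda>x. \<bar>f x\<bar>) = \<bar>\<psi> f\<bar>"
proof -
  have eq: "(\<lambda>x. \<bar>f x\<bar>) = f - 2 *\<^sub>R inf f 0"
    by (auto simp: fun_eq_iff inf_min min_def)
  show "(\<lambda>x. \<bar>f x\<bar>) \<in> L" using f by (simp add: eq closed)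
  show "\<psi> (\<lambda>x. \<bar>f x\<bar>) = \<bar>\<psi> f\<bar>"
    using f by (simp add: eq closed diff scaleR inf_zero min_def)
qed

section \<open>Simultaneous approximation of finitely many values\<close>

lemma dominating_null_function:
  assumes "finite F" "F \<subseteq> L" "u \<in> L" "\<psi> u = 1"
  shows "\<exists>G\<in>L. \<psi> G = 0 \<and> 0 \<le> G \<and> (\<forall>f\<in>F. \<forall>x. \<bar>f x - \<psi> f * u x\<bar> \<le> G x)"
  using assms(1,2)
proof (induction F rule: finite_induct)
  case empty
  show ?case by (intro bexI[OF _ closed(1)] conjI zero) simp_all
next
  case (insert h F)
  then obtain G where G: "G \<in> L" "\<psi> G = 0" "0 \<le> G"
    "\<And>f x. f \<in> F \<Longrightarrow> \<bar>f x - \<psi> f * u x\<bar> \<le> G x" by blast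
  define k where "k = h - \<psi> h *\<^sub>R u"
  define H where "H = G + (\<lambda>x. \<bar>k x\<bar>)"
  \<comment> \<open>Because \<open>\<psi> u = 1\<close>, subtracting
    \<open>\<psi> h *\<^sub>R u\<close> moves \<open>h\<close> into the kernel, and
    \<open>abs\<close> keeps the absolute value there.\<close>
  have k: "k \<in> L" "\<psi> k = 0"
    using insert.prems assms(3,4) by (simp_all add: k_def closed diff scaleR)
  have "H \<in> L" "\<psi> H = 0" using G k abs[OF k(1)] by (simp_all add: H_def closed add)
  moreover have "0 \<le> H" using G by (simp add: H_def le_fun_def)
  moreover have "\<bar>f x - \<psi> f * u x\<bar> \<le> H x" if "f \<in> insert h F" for f x
  proof (cases "f = h")
    case True
    then show ?thesis using G(3) by (simp add: H_def k_def le_fun_def)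
  next
    case False
    then show ?thesis using that G(4)[of f x] by (simp add: H_def)
  qed
  ultimately show ?case by blast
qed

lemma finite_approximation:
  assumes F: "finite F" "F \<subseteq> L" and e: "\<epsilon> > 0"
  shows "\<exists>x. \<forall>f\<in>F. \<bar>\<psi> f - f x\<bar> \<le> \<epsilon>"
proof -
  obtain g where g: "g \<in> L" "\<psi> g \<noteq> 0"
    using hom by (auto simp: truncation_homomorphism_def nonzero_on_def)
  \<comment> \<open>The value 2 exceeds the truncation level by 1, so both \<open>u\<close> and
    \<open>v - u\<close> get the value 1.\<close>
  define v where "v = (2 / \<psi> g) *\<^sub>R g"
  have v: "v \<in> L" "\<psi> v = 2" using g by (simp_all add: v_def closed scaleR)
  define u where "u = inf v 1"
  have u: "u \<in> L" "\<psi> u = 1" using v by (simp_all add: u_def closed inf_one)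
  \<comment> \<open>The cut at \<open>\<epsilon>\<close> leaves a positive value and will bound
    \<open>G\<close> at the chosen point.\<close>
  define w where "w = inf (v - u) (\<lambda>_. \<epsilon>)"
  have vu: "v - u \<in> L" "\<psi> (v - u) = 1" using u v by (simp_all add: closed diff)
  have w: "w \<in> L" "\<psi> w > 0"
    using inf_const[OF vu(1) e] vu e by (simp_all add: w_def)
  obtain G where G: "G \<in> L" "\<psi> G = 0" "0 \<le> G"
    "\<And>f x. f \<in> F \<Longrightarrow> \<bar>f x - \<psi> f * u x\<bar> \<le> G x"
    using dominating_null_function[OF F u] by blast
  have "\<not> w \<le> G" using mono[OF w(1) G(1)] w(2) G(2) by auto
  then obtain x where x: "G x < w x" by (auto simp: le_fun_def not_le)
  have "0 \<le> G x" using G(3) by (simp add: le_fun_def)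
  \<comment> \<open>From \<open>0 \<le> G x < w x\<close> it follows that \<open>v x > 1\<close>, so
    the truncation \<open>u\<close> equals 1 there and the bound by \<open>G\<close> becomes a bound
    on \<open>f x - \<psi> f\<close>.\<close>
  with x have "u x = 1" "w x \<le> \<epsilon>" by (auto simp: w_def u_def inf_min min_def split: if_splits)
  then have "\<bar>\<psi> f - f x\<bar> \<le> \<epsilon>" if "f \<in> F" for f
    using G(4)[OF that, of x] x by (simp add: abs_minus_commute)
  then show ?thesis by blast
qed

end

section \<open>From nets and approximate evaluations back to truncation homomorphisms\<close>

lemma tail_filter_neq_bot:
  assumes "directed_set D le"
  shows "tail_filter D le \<noteq> bot"
proof
  assume "tail_filter D le = bot"
  then have "eventually (\<lambda>_. False) (tail_filter D le)" by simp
  then show False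
    using assms unfolding eventually_tail_filter[OF assms] directed_set_def reflp_on_def by blast
qed

text \<open>By continuity of \<open>min\<close>, both sides of the truncation identity are limits of
  the same real net, and limits along a proper filter are unique.\<close>

lemma net_limit_on_imp_truncation_homomorphism:
  assumes "truncated_vector_sublattice L" "linear_functional_on L \<psi>" "nonzero_on L \<psi>"
    and "net_limit_on D le x L \<psi>"
  shows "truncation_homomorphism L \<psi>"
proof -
  have "\<psi> (inf f 1) = min (\<psi> f) 1" if f: "f \<in> L" for f
  proof (rule tendsto_unique)
    show "tail_filter D le \<noteq> bot"
      using assms(4) by (simp add: net_limit_on_def tail_filter_neq_bot)
    have "inf f 1 \<in> L" using assms(1) f by (simp add: truncated_vector_sublattice_def)
    then show "((\<lambda>\<sigma>. inf f 1 (x \<sigma>)) \<longlongrightarrow> \<psi> (inf f 1)) (tail_filter D le)"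
      using assms(4) by (simp only: net_limit_on_def)
    have "((\<lambda>\<sigma>. min (f (x \<sigma>)) 1) \<longlongrightarrow> min (\<psi> f) 1) (tail_filter D le)"
      using assms(4) f by (intro tendsto_min tendsto_const) (simp add: net_limit_on_def)
    then show "((\<lambda>\<sigma>. inf f 1 (x \<sigma>)) \<longlongrightarrow> min (\<psi> f) 1) (tail_filter D le)"
      by (simp add: inf_min)
  qed
  with assms show ?thesis by (simp add: truncation_homomorphism_def)
qed

text \<open>Two functions suffice: \<open>f\<close> and \<open>inf f 1\<close> are approximated at
  one common point, where the truncation identity holds exactly.\<close>

lemma approx_evaluation_2_imp_truncation_homomorphism:
  assumes "truncated_vector_sublattice L" "nonzero_on L \<psi>" "approx_evaluation 2 L \<psi>"
  shows "truncation_homomorphism L \<psi>"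
proof -
  have "\<psi> (inf f 1) = min (\<psi> f) 1" if f: "f \<in> L" for f
  proof -
    have "\<bar>\<psi> (inf f 1) - min (\<psi> f) 1\<bar> \<le> 0 + \<epsilon>" if e: "\<epsilon> > 0" for \<epsilon>
    proof -
      define h where "h = (\<lambda>k::nat. if k = 1 then f else inf f 1)"
      have "\<forall>k\<in>{1..2}. h k \<in> L"
        using assms(1) f by (simp add: h_def truncated_vector_sublattice_def)
      moreover have "\<epsilon> / 2 > 0" using e by simp
      ultimately obtain x where x: "\<And>k. k \<in> {1..2} \<Longrightarrow> \<bar>\<psi> (h k) - h k x\<bar> \<le> \<epsilon> / 2"
        using assms(3) unfolding approx_evaluation_def by meson
      have "\<bar>\<psi> f - f x\<bar> \<le> \<epsilon> / 2" "\<bar>\<psi> (inf f 1) - min (f x) 1\<bar> \<le> \<epsilon> / 2"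
        using x[of 1] x[of 2] by (simp_all add: h_def inf_min)
      \<comment> \<open>Truncation of reals at 1 is 1-Lipschitz, so the two errors of
        \<open>\<epsilon> / 2\<close> add up to at most \<open>\<epsilon>\<close>.\<close>
      then show ?thesis by linarith
    qed
    then have "\<bar>\<psi> (inf f 1) - min (\<psi> f) 1\<bar> \<le> 0" by (rule field_le_epsilon)
    then show ?thesis by simp
  qed
  with assms show ?thesis
    by (simp add: truncation_homomorphism_def approx_evaluation_def)
qed

section \<open>Evaluations and a convergent net from a truncation homomorphism\<close>

context truncation_homomorphism_on
begin

lemma approx_evaluation: "approx_evaluation n L \<psi>"
  unfolding approx_evaluation_def
proof (intro conjI allI impI linear)
  fix f :: "nat \<Rightarrow> 'x \<Rightarrow> real" and \<epsilon> :: real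
  assume "\<forall>k\<in>{1..n}. f k \<in> L" "\<epsilon> > 0"
  then show "\<exists>x. \<forall>k\<in>{1..n}. \<bar>\<psi> (f k) - f k x\<bar> \<le> \<epsilon>"
    using finite_approximation[of "f ` {1..n}" \<epsilon>] by auto
qed

lemma net_limit_on: "\<exists>(D :: ('x set \<times> 'x) set) le x. net_limit_on D le x L \<psi>"
proof -
  define B where "B = (\<lambda>F (\<epsilon>::real). {x. \<forall>f\<in>F. \<bar>\<psi> f - f x\<bar> \<le> \<epsilon>})"
  \<comment> \<open>An index is a superset of some basic set \<open>B F \<epsilon>\<close> together
    with a point of it; the net returns that point.\<close>
  define D where "D = {(A, a). a \<in> A \<and> (\<exists>F \<epsilon>. finite F \<and> F \<subseteq> L \<and> \<epsilon> > 0 \<and> B F \<epsilon> \<subseteq> A)}"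
  define le where "le = (\<lambda>(p :: 'x set \<times> 'x) (q :: 'x set \<times> 'x). fst q \<subseteq> fst p)"
  have B: "\<exists>a. (B F \<epsilon>, a) \<in> D" if "finite F" "F \<subseteq> L" "\<epsilon> > 0" for F \<epsilon>
    using finite_approximation[OF that] that by (fastforce simp: D_def B_def)
  have dir: "directed_set D le"
    unfolding directed_set_def
  proof (intro conjI ballI)
    show "D \<noteq> {}" using B[of "{}" 1] by auto
    show "reflp_on D le" "transp_on D le"
      by (auto simp: reflp_on_def transp_on_def le_def)
    fix p q assume "p \<in> D" "q \<in> D"
    then obtain F d G e where F: "finite F" "F \<subseteq> L" "d > 0" "B F d \<subseteq> fst p"
      and G: "finite G" "G \<subseteq> L" "e > 0" "B G e \<subseteq> fst q"
      by (auto simp: D_def)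
    obtain a where "(B (F \<union> G) (min d e), a) \<in> D"
      using B[of "F \<union> G" "min d e"] F G by auto
    \<comment> \<open>More functions and a smaller tolerance shrink \<open>B\<close>, which gives
      directedness.\<close>
    moreover have "B (F \<union> G) (min d e) \<subseteq> B F d \<inter> B G e" by (auto simp: B_def)
    ultimately show "\<exists>r\<in>D. le p r \<and> le q r"
      using F(4) G(4) by (intro rev_bexI) (auto simp: le_def)
  qed
  have "((\<lambda>p. f (snd p)) \<longlongrightarrow> \<psi> f) (tail_filter D le)" if f: "f \<in> L" for f
  proof (rule tendstoI)
    fix e :: real assume e: "e > 0"
    \<comment> \<open>Halving \<open>e\<close> turns the weak inequality in \<open>B\<close> into
      the strict one required for convergence.\<close>
    obtain a where "(B {f} (e / 2), a) \<in> D" using B[of "{f}" "e / 2"] f e by auto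
    moreover have "dist (f (snd q)) (\<psi> f) < e" if "q \<in> D" "le (B {f} (e / 2), a) q" for q
    proof -
      have "snd q \<in> B {f} (e / 2)" using that by (auto simp: D_def le_def)
      then show ?thesis using e by (simp add: B_def dist_real_def abs_minus_commute)
    qed
    ultimately show "eventually (\<lambda>p. dist (f (snd p)) (\<psi> f) < e) (tail_filter D le)"
      unfolding eventually_tail_filter[OF dir] by blast
  qed
  with dir show ?thesis unfolding net_limit_on_def by blast
qed

end

text \<open>The existential over nets fixes one index type; the last conjunct lets the index type
  vary freely, so a net of any type forces the truncation identity.\<close>

theorem theorem3p3:
  fixes L :: "('x \<Rightarrow> real) set" and \<psi> :: "('x \<Rightarrow> real) \<Rightarrow> real"
  assumes "truncated_vector_sublattice L"
    and "linear_functional_on L \<psi>"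
    and "nonzero_on L \<psi>"
  shows "(truncation_homomorphism L \<psi> \<longleftrightarrow> (\<forall>n\<ge>1. approx_evaluation n L \<psi>))
    \<and> (truncation_homomorphism L \<psi> \<longleftrightarrow> approx_evaluation 2 L \<psi>)
    \<and> (truncation_homomorphism L \<psi> \<longleftrightarrow>
        (\<exists>(D :: ('x set \<times> 'x) set) le x. net_limit_on D le x L \<psi>))
    \<and> (\<forall>(D :: 'i set) le x. net_limit_on D le x L \<psi> \<longrightarrow> truncation_homomorphism L \<psi>)"
proof -
  have evaluation: "approx_evaluation n L \<psi>" if "truncation_homomorphism L \<psi>" for n
    using truncation_homomorphism_on.approx_evaluation truncation_homomorphism_on.intro
      assms(1) that by blast
  have net: "\<exists>(D :: ('x set \<times> 'x) set) le x. net_limit_on D le x L \<psi>"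
    if "truncation_homomorphism L \<psi>"
    using truncation_homomorphism_on.net_limit_on truncation_homomorphism_on.intro
      assms(1) that by blast
  have two: "truncation_homomorphism L \<psi>" if "approx_evaluation 2 L \<psi>"
    using approx_evaluation_2_imp_truncation_homomorphism assms(1,3) that .
  have all: "approx_evaluation 2 L \<psi>" if "\<forall>n\<ge>1. approx_evaluation n L \<psi>"
    using that by simp
  note limit = net_limit_on_imp_truncation_homomorphism[OF assms]
  show ?thesis
  proof (intro conjI)
    show "truncation_homomorphism L \<psi> \<longleftrightarrow> (\<forall>n\<ge>1. approx_evaluation n L \<psi>)"
      "truncation_homomorphism L \<psi> \<longleftrightarrow> approx_evaluation 2 L \<psi>"
      using evaluation two all by blast+
    show "truncation_homomorphism L \<psi> \<longleftrightarrow>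
        (\<exists>(D :: ('x set \<times> 'x) set) le x. net_limit_on D le x L \<psi>)"
      using net limit by blast
    show "\<forall>(D :: 'i set) le x. net_limit_on D le x L \<psi> \<longrightarrow> truncation_homomorphism L \<psi>"
      using limit by blast
  qed
qed

end
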